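(* Let $m\ge2$, let $h$ be a positive integer and let $\lambda=(\lambda_1,\ldots,\lambda_{m-1},0)$ be a partition with $\lambda_m=0$. Let $\lambda^{(0)},\ldots,\lambda^{(N)}$ be the sequence of dominating partitions for $G_{h,\lambda}(\mathbf{x})$, write $\lambda^{(N)}=(\lambda_1+a_1,\ldots,\lambda_m+a_m)$ and $b_k=a_1+\cdots+a_k$. Let $k\in\{1,\ldots,m\}$, let $I$ be a proper nonempty subset of $[m]$, and let $F=F(I)$ be a facet of $\mathrm{Newt}(s_{\lambda^{(b_k)}}(\mathbf{x}))$ defined by the inequality $\sum_{i\in I}x_i\le\sum_{i=1}^{|I|}\lambda^{(b_k)}_i=:L$. Let $H(F)$ be one of the two hyperplanes $H(F)_1=\{\mathbf{x}\in\mathbb{R}^m:\sum_{i\in I}x_i=L\}$, $H(F)_0=\{\mathbf{x}\in\mathbb{R}^m:\sum_{i\notin I}x_i=|\lambda^{(b_k)}|-L\}$, and suppose $H(F)$ isolates $\mathrm{Newt}(G_{h,\lambda}(\mathbf{x}))$ and is not of the form $\mathcal{J}_j=\{\mathbf{x}\in\mathbb{R}^m:\sum_{i\ne j}x_i=|\lambda|-\lambda_1\}$ for any $j\in[m]$. Then $H(F)$ is a facet-defining hyperplane of $\mathrm{Newt}(G_{h,\lambda}(\mathbf{x}))$.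
   Context: $\mathbf{x}=(x_1,\ldots,x_m)$, $[m]=\{1,\ldots,m\}$. $\mathrm{Newt}(f)$ is the convex hull of exponent vectors of monomials with nonzero coefficient in $f$. Schur polynomial $s_\mu(x_1,\ldots,x_m)=\sum_T\mathbf{x}^T$ over semistandard Young tableaux of shape $\mu$ with entries in $[m]$; $\mathrm{Newt}(s_\mu)$ is the convex hull of the $S_m$-orbit of $\mu$, an $(m-1)$-dimensional polytope in the hyperplane $\sum x_i=|\mu|$ (when $\mu$ is not constant), whose facets are cut out by inequalities $\sum_{i\in I}x_i\le\sum_{i=1}^{|I|}\mu_i$. For a partition $\mu\supseteq\lambda$ with at most $m$ rows, $b_{h,\lambda\mu}$ is the number of fillings of $\mu/\lambda$ with positive integers strictly increasing along rows and columns, entries in row $r$ from $\{1,\ldots,h(r-1)\}$; $A(h,\lambda)=\{\mu\mid b_{h,\lambda\mu}\ne0\}$; $G_{h,\lambda}(\mathbf{x})=\sum_{\mu\in A(h,\lambda)}(-1)^{|\mu/\lambda|}b_{h,\lambda\mu}s_\mu(\mathbf{x})$. Sequence of dominating partitions: $\lambda^{(0)}=\lambda$; for $k\ge1$, $\lambda^{(k)}$ is obtained from $\lambda^{(k-1)}$ by adding a box in row $r_k$, the smallest $r_k\in[m]$ with $\lambda^{(k-1)}_{r_k}-\lambda_{r_k}<h(r_k-1)$ such that adding a box in that row gives a partition; it runs up to $\lambda^{(N)}$ where $\deg G_{h,\lambda}=|\lambda|+N$. A hyperplane $H=\{f(\mathbf{x})=a\}$ ($f$ linear) isolates a set $S$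 if $S\subseteq\{f\ge a\}$ or $S\subseteq\{f\le a\}$. A hyperplane $H$ is facet-defining for the ($m$-dimensional) polytope $\mathcal{P}$ if it isolates $\mathcal{P}$ and $\dim(\mathcal{P}\cap H)=m-1$. *)

theory Defs
  imports "HOL-Analysis.Analysis" "HOL-Library.Poly_Mapping" "HOL-Library.FuncSet"
begin

section \<open>Multivariate polynomials and Newton polytopes\<close>

text \<open>A polynomial in the variables indexed by a finite type maps exponent vectors to
  coefficients, with finite support; multiplication is the convolution product of
  \<^theory>\<open>HOL-Library.Poly_Mapping\<close>. Throughout, the number \<open>m\<close> of variables is the cardinality
  of the index type, and the linear order of that type plays the role of the order of
  \<open>[m] = {1,\<dots>,m}\<close>.\<close>

type_synonym 'm int_mpoly = "('m \<Rightarrow>\<^sub>0 nat) \<Rightarrow>\<^sub>0 int"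

definition mvar :: "'m \<Rightarrow> 'm int_mpoly" where
  "mvar i = Poly_Mapping.single (Poly_Mapping.single i 1) 1"

definition total_deg :: "'m::finite int_mpoly \<Rightarrow> nat" where
  "total_deg f = Max (insert 0 ((\<lambda>\<alpha>. \<Sum>i\<in>UNIV. Poly_Mapping.lookup \<alpha> i) ` Poly_Mapping.keys f))"

definition newton_polytope :: "'m::finite int_mpoly \<Rightarrow> (real ^ 'm) set" where
  "newton_polytope f =
     convex hull ((\<lambda>\<alpha>. \<chi> i. real (Poly_Mapping.lookup \<alpha> i)) ` Poly_Mapping.keys f)"


section \<open>Partitions and Schur polynomials\<close>

text \<open>Rows, columns and parts are numbered from 0: the part \<open>\<lambda>\<^sub>r\<close> of the usual 1-based notation is
  \<open>lam (r - 1)\<close>. A partition is extended by zero beyond its \<open>m\<close> rows, so that distinct functions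
  are distinct partitions.\<close>

definition is_partition :: "nat \<Rightarrow> (nat \<Rightarrow> nat) \<Rightarrow> bool" where
  "is_partition m mu \<longleftrightarrow> antimono mu \<and> (\<forall>r\<ge>m. mu r = 0)"

definition part_size :: "nat \<Rightarrow> (nat \<Rightarrow> nat) \<Rightarrow> nat" where
  "part_size m mu = (\<Sum>r<m. mu r)"

definition skew_cells :: "(nat \<Rightarrow> nat) \<Rightarrow> (nat \<Rightarrow> nat) \<Rightarrow> (nat \<times> nat) set" where
  "skew_cells lam mu = {(r, c). lam r \<le> c \<and> c < mu r}"

definition cells :: "(nat \<Rightarrow> nat) \<Rightarrow> (nat \<times> nat) set" where
  "cells mu = skew_cells (\<lambda>_. 0) mu"

text \<open>Fillings are extensional functions, so that they can be counted.\<close>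

definition ssyt :: "(nat \<Rightarrow> nat) \<Rightarrow> (nat \<times> nat \<Rightarrow> 'm::linorder) set" where
  "ssyt mu = {T \<in> cells mu \<rightarrow>\<^sub>E UNIV.
     (\<forall>r c c'. (r, c) \<in> cells mu \<and> (r, c') \<in> cells mu \<and> c < c' \<longrightarrow> T (r, c) \<le> T (r, c')) \<and>
     (\<forall>r r' c. (r, c) \<in> cells mu \<and> (r', c) \<in> cells mu \<and> r < r' \<longrightarrow> T (r, c) < T (r', c))}"

definition schur :: "(nat \<Rightarrow> nat) \<Rightarrow> 'm::{finite,linorder} int_mpoly" where
  "schur mu = (\<Sum>T\<in>ssyt mu. \<Prod>p\<in>cells mu. mvar (T p))"


section \<open>The polynomials \<open>G\<^sub>h\<^sub>,\<^sub>\<lambda>\<close>\<close>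

text \<open>The entries in the 1-based row \<open>r\<close> lie in \<open>{1,\<dots>,h(r-1)}\<close>; with 0-based rows the bound reads
  \<open>h * r\<close>. In particular the top row of \<open>\<mu>/\<lambda>\<close> must be empty.\<close>

definition fillings :: "nat \<Rightarrow> (nat \<Rightarrow> nat) \<Rightarrow> (nat \<Rightarrow> nat) \<Rightarrow> (nat \<times> nat \<Rightarrow> nat) set" where
  "fillings h lam mu = {T \<in> (\<Pi>\<^sub>E (r, c) \<in> skew_cells lam mu. {1..h * r}).
     (\<forall>r c c'. (r, c) \<in> skew_cells lam mu \<and> (r, c') \<in> skew_cells lam mu \<and> c < c'
        \<longrightarrow> T (r, c) < T (r, c')) \<and>
     (\<forall>r r' c. (r, c) \<in> skew_cells lam mu \<and> (r', c) \<in> skew_cells lam mu \<and> r < r'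
        \<longrightarrow> T (r, c) < T (r', c))}"

definition b_coeff :: "nat \<Rightarrow> (nat \<Rightarrow> nat) \<Rightarrow> (nat \<Rightarrow> nat) \<Rightarrow> nat" where
  "b_coeff h lam mu = card (fillings h lam mu)"

definition A_set :: "nat \<Rightarrow> nat \<Rightarrow> (nat \<Rightarrow> nat) \<Rightarrow> (nat \<Rightarrow> nat) set" where
  "A_set m h lam = {mu. is_partition m mu \<and> lam \<le> mu \<and> b_coeff h lam mu \<noteq> 0}"

definition G_poly :: "nat \<Rightarrow> (nat \<Rightarrow> nat) \<Rightarrow> 'm::{finite,linorder} int_mpoly" where
  "G_poly h lam = (\<Sum>mu\<in>A_set CARD('m) h lam.
     (- 1) ^ card (skew_cells lam mu) * of_nat (b_coeff h lam mu) * schur mu)"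


section \<open>The sequence of dominating partitions\<close>

definition addable_row :: "nat \<Rightarrow> nat \<Rightarrow> (nat \<Rightarrow> nat) \<Rightarrow> (nat \<Rightarrow> nat) \<Rightarrow> nat \<Rightarrow> bool" where
  "addable_row m h lam mu r \<longleftrightarrow>
     r < m \<and> mu r < lam r + h * r \<and> is_partition m (mu(r := Suc (mu r)))"

text \<open>Only the terms up to index \<open>N = deg G\<^sub>h\<^sub>,\<^sub>\<lambda> - |\<lambda>|\<close> are meaningful: afterwards no row is
  addable and the least such row is unspecified.\<close>

primrec dom_part :: "nat \<Rightarrow> nat \<Rightarrow> (nat \<Rightarrow> nat) \<Rightarrow> nat \<Rightarrow> (nat \<Rightarrow> nat)" where
  "dom_part m h lam 0 = lam"
| "dom_part m h lam (Suc k) =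
     (let mu = dom_part m h lam k; r = (LEAST r. addable_row m h lam mu r)
      in mu(r := Suc (mu r)))"


section \<open>Isolating and facet-defining hyperplanes\<close>

definition isolates :: "(real ^ 'm) set \<Rightarrow> (real ^ 'm) set \<Rightarrow> bool" where
  "isolates H S \<longleftrightarrow> (\<exists>f a. linear f \<and> f \<noteq> (\<lambda>_. 0) \<and> H = {x. f x = (a::real)} \<and>
     (S \<subseteq> {x. f x \<ge> a} \<or> S \<subseteq> {x. f x \<le> a}))"

definition facet_defining :: "(real ^ 'm) set \<Rightarrow> (real ^ 'm) set \<Rightarrow> bool" where
  "facet_defining H P \<longleftrightarrow> isolates H P \<and> aff_dim (P \<inter> H) = int CARD('m) - 1"

definition J_plane :: "(nat \<Rightarrow> nat) \<Rightarrow> 'm \<Rightarrow> (real ^ 'm::finite) set" where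
  "J_plane lam j =
     {x. (\<Sum>i\<in>UNIV - {j}. x $ i) = real (part_size CARD('m) lam) - real (lam 0)}"

end

theory Submission
  imports Defs
begin

text \<open>The facet \<open>F\<close> has dimension \<open>m - 2\<close> and lies both in \<open>H\<close> and in a hyperplane of constant
  coordinate sum, so it suffices to find a point of the polytope of \<open>G\<^sub>h\<^sub>,\<^sub>\<lambda>\<close> in \<open>H\<close> with another
  coordinate sum. Since no monomials cancel, that polytope contains all permutations of every
  \<open>\<nu>\<close> with \<open>b_coeff h \<lambda> \<nu> \<noteq> 0\<close>, and these \<open>\<nu>\<close> are the partitions with
  \<open>\<lambda>\<^sub>r \<le> \<nu>\<^sub>r \<le> \<lambda>\<^sub>r + h * r\<close> in the 0-based row \<open>r\<close>. That the dominating
  partitions are among them is all that matters about \<open>\<mu>\<close>. One adds a box to \<open>\<mu>\<close> or removes one; if this box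
  changes the coordinate sum that defines \<open>H\<close>, then \<open>H\<close> does not isolate. Only for \<open>\<mu> = \<lambda>\<close> can such
  a box be missing, and then either \<open>H\<close> is some \<open>\<J>\<^sub>j\<close> or \<open>F\<close> is too small to be a facet.\<close>

section \<open>Skew fillings and the set of shapes\<close>

lemma mem_cells: "(r, c) \<in> cells mu \<longleftrightarrow> c < mu r"
  by (simp add: cells_def skew_cells_def)

lemma is_partition_antimonoD: "is_partition m mu \<Longrightarrow> r \<le> s \<Longrightarrow> mu s \<le> mu r"
  by (auto simp: is_partition_def monotone_on_def)

lemma is_partition_pos_row: "is_partition m mu \<Longrightarrow> c < mu r \<Longrightarrow> r < m"
  unfolding is_partition_def by (metis not_less not_less_zero)

lemma finite_skew_cells:
  assumes "is_partition m mu"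
  shows "finite (skew_cells lam mu)"
proof (rule finite_subset)
  show "skew_cells lam mu \<subseteq> {..<m} \<times> {..<mu 0}"
    using is_partition_pos_row[OF assms] is_partition_antimonoD[OF assms, of 0]
    by (auto simp: skew_cells_def intro: less_le_trans)
qed simp

lemma finite_cells: "is_partition m mu \<Longrightarrow> finite (cells mu)"
  unfolding cells_def by (rule finite_skew_cells)

lemma card_skew_cells:
  assumes "is_partition m mu" and le: "lam \<le> mu"
  shows "card (skew_cells lam mu) = part_size m mu - part_size m lam"
proof -
  have "skew_cells lam mu = (SIGMA r:{..<m}. {lam r..<mu r})"
    using is_partition_pos_row[OF assms(1)] by (auto simp: skew_cells_def)
  then have "card (skew_cells lam mu) = (\<Sum>r<m. mu r - lam r)"
    by simp
  also have "\<dots> = (\<Sum>r<m. mu r) - (\<Sum>r<m. lam r)"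
    using le by (intro sum_subtractf_nat) (auto simp: le_fun_def)
  finally show ?thesis by (simp add: part_size_def)
qed

lemma card_cells: "is_partition m mu \<Longrightarrow> card (cells mu) = part_size m mu"
  unfolding cells_def by (subst card_skew_cells) (auto simp: le_fun_def part_size_def)

lemma is_partition_add_box:
  assumes "is_partition m mu" "r < m" "0 < r \<Longrightarrow> mu r < mu (r - 1)"
  shows "is_partition m (mu(r := Suc (mu r)))"
proof -
  have "mu r < mu s" if "s < r" for s
    using is_partition_antimonoD[OF assms(1), of s "r - 1"] assms(3) that by linarith
  then show ?thesis
    using assms(1,2) is_partition_antimonoD[OF assms(1)]
    by (auto simp: is_partition_def antimono_def le_Suc_eq Suc_le_eq)
qed

lemma is_partition_remove_box:
  assumes "is_partition m mu" "mu (Suc r) < mu r"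
  shows "is_partition m (mu(r := mu r - 1))"
proof -
  have "mu s < mu r" if "r < s" for s
    using is_partition_antimonoD[OF assms(1), of "Suc r" s] assms(2) that by linarith
  then have "mu s \<le> mu r - 1" if "r < s" for s
    using that by fastforce
  moreover have "mu r - 1 \<le> mu s" if "s \<le> r" for s
    using is_partition_antimonoD[OF assms(1) that] by linarith
  ultimately show ?thesis
    using assms(1) is_partition_antimonoD[OF assms(1)]
    by (auto simp: is_partition_def antimono_def)
qed

lemma finite_fillings:
  assumes "is_partition m mu"
  shows "finite (fillings h lam mu)"
proof (rule finite_subset)
  show "fillings h lam mu \<subseteq> (\<Pi>\<^sub>E (r, c) \<in> skew_cells lam mu. {1..h * r})"
    by (auto simp: fillings_def)
qed (intro finite_PiE finite_skew_cells[OF assms], auto)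

text \<open>The filling pushes the entries of every row as close as possible to the bound
  \<open>h * r\<close> of that row; the columns are then strict because the bounds increase.\<close>

lemma b_coeff_nonzero_iff:
  assumes "is_partition m mu" "h \<ge> 1" "lam \<le> mu"
  shows "b_coeff h lam mu \<noteq> 0 \<longleftrightarrow> (\<forall>r. mu r \<le> lam r + h * r)"
proof
  assume "b_coeff h lam mu \<noteq> 0"
  then obtain T where T: "T \<in> fillings h lam mu"
    by (metis b_coeff_def card.empty equals0I)
  show "\<forall>r. mu r \<le> lam r + h * r"
  proof
    fix r
    let ?f = "\<lambda>c. T (r, c)"
    \<comment> \<open>Pigeonhole: the cells of a row need as many distinct entries, and only
      \<open>h * r\<close> values are available.\<close>
    have "inj_on ?f {lam r..<mu r}"
    proof (rule linorder_inj_onI)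
      fix c c' assume "c < c'" "c \<in> {lam r..<mu r}" "c' \<in> {lam r..<mu r}"
      then have "(r, c) \<in> skew_cells lam mu \<and> (r, c') \<in> skew_cells lam mu \<and> c < c'"
        by (simp add: skew_cells_def)
      then have "T (r, c) < T (r, c')"
        using T unfolding fillings_def by blast
      then show "T (r, c) \<noteq> T (r, c')" by simp
    qed auto
    moreover have "?f ` {lam r..<mu r} \<subseteq> {1..h * r}"
    proof (rule image_subsetI)
      fix c assume "c \<in> {lam r..<mu r}"
      then have "(r, c) \<in> skew_cells lam mu"
        by (simp add: skew_cells_def)
      moreover have "T \<in> (\<Pi>\<^sub>E (r, c) \<in> skew_cells lam mu. {1..h * r})"
        using T unfolding fillings_def by blast
      ultimately show "T (r, c) \<in> {1..h * r}"
        by (auto dest: PiE_mem)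
    qed
    ultimately have "card {lam r..<mu r} \<le> card {1..h * r}"
      by (metis card_inj_on_le finite_atLeastAtMost)
    then show "mu r \<le> lam r + h * r" by simp
  qed
next
  assume le: "\<forall>r. mu r \<le> lam r + h * r"
  \<comment> \<open>The last cell \<open>c = mu r - 1\<close> of a row gets \<open>h * r\<close>.
    The truncated subtraction is safe, since
    \<open>mu r \<le> lam r + h * r \<le> c + h * r\<close>.\<close>
  let ?T = "\<lambda>(r, c). if (r, c) \<in> skew_cells lam mu then h * r + c + 1 - mu r else undefined"
  have "?T \<in> fillings h lam mu"
    unfolding fillings_def
  proof (intro CollectI conjI allI impI)
    show "?T \<in> (\<Pi>\<^sub>E (r, c) \<in> skew_cells lam mu. {1..h * r})"
    proof (rule PiE_I)
      fix p assume p: "p \<in> skew_cells lam mu"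
      obtain r c where rc: "p = (r, c)" by fastforce
      have "mu r \<le> lam r + h * r" using le by blast
      then show "?T p \<in> (case p of (r, c) \<Rightarrow> {1..h * r})"
        using p by (auto simp: rc skew_cells_def)
    qed auto
    show "?T (r, c) < ?T (r, c')"
      if "(r, c) \<in> skew_cells lam mu \<and> (r, c') \<in> skew_cells lam mu \<and> c < c'" for r c c'
    proof -
      have "mu r \<le> lam r + h * r" using le by blast
      then show ?thesis using that by (clarsimp simp: skew_cells_def; linarith)
    qed
    show "?T (r, c) < ?T (r', c)"
      if "(r, c) \<in> skew_cells lam mu \<and> (r', c) \<in> skew_cells lam mu \<and> r < r'" for r r' c
    proof -
      have "mu r \<le> lam r + h * r" "mu r' \<le> mu r" "h * r < h * r'"
        using le that is_partition_antimonoD[OF assms(1), of r r'] assms(2) by auto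
      then show ?thesis using that by (clarsimp simp: skew_cells_def; linarith)
    qed
  qed
  then show "b_coeff h lam mu \<noteq> 0"
    unfolding b_coeff_def using finite_fillings[OF assms(1)] by auto
qed

text \<open>Lets all later moves of boxes be checked by inequalities between row lengths instead of
  fillings.\<close>

lemma mem_A_set_iff:
  assumes "h \<ge> 1"
  shows "mu \<in> A_set m h lam \<longleftrightarrow>
    is_partition m mu \<and> lam \<le> mu \<and> (\<forall>r. mu r \<le> lam r + h * r)"
  using b_coeff_nonzero_iff[OF _ assms] by (auto simp: A_set_def)

lemma finite_A_set:
  assumes "h \<ge> 1"
  shows "finite (A_set m h lam)"
proof (rule finite_subset)
  \<comment> \<open>The sum serves only as one bound common to all rows.\<close>
  show "A_set m h lam \<subseteq> {mu. \<forall>r. (r \<in> {..<m} \<longrightarrow> mu r \<in> {..\<Sum>r<m. (lam r + h * r)}) \<and> (r \<notin> {..<m} \<longrightarrow> mu r = 0)}"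
  proof
    fix mu assume mu: "mu \<in> A_set m h lam"
    have "mu r \<le> (\<Sum>r<m. (lam r + h * r))" if "r < m" for r
    proof -
      have "mu r \<le> lam r + h * r" using mu mem_A_set_iff[OF assms] by blast
      also have "\<dots> \<le> (\<Sum>r<m. (lam r + h * r))"
        using that member_le_sum[of r "{..<m}" "\<lambda>r. lam r + h * r"] by simp
      finally show ?thesis .
    qed
    then show "mu \<in> {mu. \<forall>r. (r \<in> {..<m} \<longrightarrow> mu r \<in> {..\<Sum>r<m. (lam r + h * r)}) \<and> (r \<notin> {..<m} \<longrightarrow> mu r = 0)}"
      using mu mem_A_set_iff[OF assms] by (auto simp: is_partition_def)
  qed
  show "finite {mu. \<forall>r. (r \<in> {..<m} \<longrightarrow> mu r \<in> {..\<Sum>r<m. (lam r + h * r)}) \<and> (r \<notin> {..<m} \<longrightarrow> mu r = (0::nat))}"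
    by (intro finite_set_of_finite_funs) auto
qed

section \<open>Adding boxes and the dominating sequence\<close>

lemma part_size_add_box:
  "r < m \<Longrightarrow> part_size m (mu(r := Suc (mu r))) = Suc (part_size m mu)"
  unfolding part_size_def by (simp add: sum.remove[of "{..<m}" r])

lemma add_box_mem_A_set:
  assumes "h \<ge> 1" "mu \<in> A_set m h lam" "addable_row m h lam mu r"
  shows "mu(r := Suc (mu r)) \<in> A_set m h lam"
  using assms mem_A_set_iff[OF assms(1)]
  by (auto simp: addable_row_def le_fun_def le_Suc_eq)

text \<open>If \<open>nu\<close> exceeded \<open>mu\<close> first in row \<open>Suc r\<close>, then
  \<open>mu (Suc r) < nu (Suc r) \<le> nu r \<le> mu r\<close>, and this row would be addable. So
  adding boxes can get stuck only at the largest shape.\<close>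

lemma maximal_of_no_addable_row:
  assumes "h \<ge> 1" "mu \<in> A_set m h lam" "nu \<in> A_set m h lam"
    and "\<And>r. \<not> addable_row m h lam mu r"
  shows "nu \<le> mu"
proof (rule le_funI)
  have mu: "is_partition m mu" "lam \<le> mu"
    using assms(1,2) mem_A_set_iff by auto
  have nu: "is_partition m nu" "\<And>r. nu r \<le> lam r + h * r"
    using assms(1,3) mem_A_set_iff by auto
  fix r show "nu r \<le> mu r"
  proof (induction r)
    case 0
    \<comment> \<open>In row 0 the bound \<open>h * r\<close> is 0, so
      \<open>nu 0 \<le> lam 0\<close>.\<close>
    show ?case using nu(2)[of 0] mu(2) by (auto simp: le_fun_def intro: order_trans)
  next
    case (Suc r)
    show ?case
    proof (rule ccontr)
      assume less: "\<not> nu (Suc r) \<le> mu (Suc r)"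
      then have "Suc r < m"
        using nu(1) unfolding is_partition_def by (metis le0 not_less)
      moreover have "mu (Suc r) < mu r"
        using less Suc is_partition_antimonoD[OF nu(1), of r "Suc r"] by linarith
      ultimately have "addable_row m h lam mu (Suc r)"
        using less nu(2)[of "Suc r"] is_partition_add_box[OF mu(1), of "Suc r"]
        by (auto simp: addable_row_def)
      then show False using assms(4) by blast
    qed
  qed
qed

text \<open>The shape \<open>nu\<close> shows that no step before \<open>N\<close> gets stuck: a
  shape without addable row would contain \<open>nu\<close> and have at least its size. Hence every
  \<open>LEAST\<close> used up to index \<open>N\<close> ranges over a nonempty set of rows.\<close>

lemma dom_part_mem_A_set:
  assumes "h \<ge> 1" "is_partition m lam" "nu \<in> A_set m h lam" "part_size m nu = part_size m lam + N"
    and "j \<le> N"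
  shows "dom_part m h lam j \<in> A_set m h lam \<and> part_size m (dom_part m h lam j) = part_size m lam + j"
  using assms(5)
proof (induction j)
  case 0
  then show ?case using assms(1,2) mem_A_set_iff by auto
next
  case (Suc j)
  let ?mu = "dom_part m h lam j"
  have mu: "?mu \<in> A_set m h lam" "part_size m ?mu = part_size m lam + j"
    using Suc by auto
  have "\<exists>r. addable_row m h lam ?mu r"
  proof (rule ccontr)
    assume "\<not> ?thesis"
    then have "nu \<le> ?mu"
      using maximal_of_no_addable_row assms mu by blast
    then have "part_size m nu \<le> part_size m ?mu"
      unfolding part_size_def by (intro sum_mono) (auto simp: le_fun_def)
    then show False using mu assms(4) Suc.prems by linarith
  qed
  then have add: "addable_row m h lam ?mu (LEAST r. addable_row m h lam ?mu r)" (is "addable_row _ _ _ _ ?r")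
    by (metis LeastI)
  then have "?r < m" by (simp add: addable_row_def)
  moreover have "dom_part m h lam (Suc j) = ?mu(?r := Suc (?mu ?r))"
    by (simp add: Let_def)
  ultimately show ?case
    using add_box_mem_A_set[OF assms(1) mu(1) add] mu(2)
    by (simp only: part_size_add_box add_Suc_right)
qed


section \<open>Key tableaux and monomials\<close>

text \<open>Otherwise the \<open>r + 1\<close> smallest elements of \<open>A\<close> would all be
  among the first \<open>r\<close> elements of \<open>B\<close>. This will make the rows of the key
  tableau weakly increasing.\<close>

lemma sorted_list_of_set_nth_le:
  fixes A B :: "'a::linorder set"
  assumes "finite B" "A \<subseteq> B" "r < card A"
  shows "sorted_list_of_set B ! r \<le> sorted_list_of_set A ! r"
proof (rule ccontr)
  let ?xs = "sorted_list_of_set A" and ?ys = "sorted_list_of_set B"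
  assume "\<not> ?ys ! r \<le> ?xs ! r"
  then have less: "?xs ! r < ?ys ! r" by simp
  have fin: "finite A" using assms finite_subset by blast
  have "set (take (Suc r) ?xs) \<subseteq> set (take r ?ys)"
  proof
    fix x assume x: "x \<in> set (take (Suc r) ?xs)"
    then obtain i where i: "i < length ?xs" "i \<le> r" "x = ?xs ! i"
      by (auto simp: in_set_conv_nth less_Suc_eq_le)
    then have "x \<le> ?xs ! r"
      using assms(3) by (simp add: sorted_nth_mono)
    then have "x < ?ys ! r" using less by simp
    have "x \<in> A" using i fin by (metis nth_mem set_sorted_list_of_set)
    then have "x \<in> set ?ys" using assms by auto
    then obtain j where j: "j < length ?ys" "x = ?ys ! j"
      by (metis in_set_conv_nth)
    have "j < r"
    proof (rule ccontr)
      assume "\<not> j < r"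
      then have "?ys ! r \<le> ?ys ! j"
        using j by (simp add: sorted_nth_mono)
      then show False using \<open>x < ?ys ! r\<close> j by simp
    qed
    then show "x \<in> set (take r ?ys)"
      using j by (auto simp: in_set_conv_nth)
  qed
  then have "card (set (take (Suc r) ?xs)) \<le> card (set (take r ?ys))"
    by (simp add: card_mono)
  also have "\<dots> \<le> r"
    by (rule order_trans[OF card_length]) simp
  also have "card (set (take (Suc r) ?xs)) = Suc r"
    using assms(3) fin by (simp add: distinct_card)
  finally show False by simp
qed

section \<open>Weights of tableaux\<close>

definition tableau_weight :: "(nat \<Rightarrow> nat) \<Rightarrow> (nat \<times> nat \<Rightarrow> 'm) \<Rightarrow> 'm \<Rightarrow>\<^sub>0 nat" where
  "tableau_weight mu T = (\<Sum>p\<in>cells mu. Poly_Mapping.single (T p) 1)"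

lemma lookup_tableau_weight:
  assumes "finite (cells mu)"
  shows "Poly_Mapping.lookup (tableau_weight mu T) i = card {p\<in>cells mu. T p = i}"
  using assms
  by (simp add: tableau_weight_def lookup_sum lookup_single when_def sum.If_cases Int_def)

lemma prod_single_one:
  "finite A \<Longrightarrow> (\<Prod>p\<in>A. Poly_Mapping.single (f p) (1::int)) = Poly_Mapping.single (\<Sum>p\<in>A. f p) 1"
  by (induction A rule: finite_induct) (simp_all add: mult_single)

lemma finite_ssyt:
  assumes "finite (cells mu)"
  shows "finite (ssyt mu :: (nat \<times> nat \<Rightarrow> 'm::{finite,linorder}) set)"
proof (rule finite_subset)
  show "ssyt mu \<subseteq> (cells mu \<rightarrow>\<^sub>E (UNIV::'m set))"
    by (auto simp: ssyt_def)
qed (use assms in \<open>auto intro: finite_PiE\<close>)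

text \<open>These coefficients are the Kostka numbers; their nonnegativity is what later excludes
  cancellation.\<close>

lemma lookup_schur:
  assumes "finite (cells mu)"
  shows "Poly_Mapping.lookup (schur mu :: 'm::{finite,linorder} int_mpoly) \<alpha> =
    int (card {T\<in>ssyt mu. tableau_weight mu T = \<alpha>})"
proof -
  have "(schur mu :: 'm int_mpoly) = (\<Sum>T\<in>ssyt mu. Poly_Mapping.single (tableau_weight mu T) 1)"
    using assms unfolding schur_def mvar_def tableau_weight_def by (simp add: prod_single_one)
  then show ?thesis
    using finite_ssyt[OF assms, where 'm='m]
    by (simp add: lookup_sum lookup_single when_def sum.If_cases Int_def eq_commute)
qed

lemma keys_schur:
  assumes "finite (cells mu)"
  shows "Poly_Mapping.keys (schur mu :: 'm::{finite,linorder} int_mpoly) = tableau_weight mu ` ssyt mu"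
  using finite_ssyt[OF assms, where 'm='m]
  by (auto simp: in_keys_iff lookup_schur[OF assms] card_eq_0_iff)

lemma sum_tableau_weight:
  fixes T :: "nat \<times> nat \<Rightarrow> 'm::finite"
  assumes "is_partition m mu"
  shows "(\<Sum>i\<in>UNIV. Poly_Mapping.lookup (tableau_weight mu T) i) = part_size m mu"
proof -
  have "(\<Sum>i\<in>UNIV. Poly_Mapping.lookup (tableau_weight mu T) i) =
      (\<Sum>p\<in>cells mu. \<Sum>i\<in>UNIV. if T p = i then 1 else 0)"
    unfolding tableau_weight_def lookup_sum lookup_single when_def by (rule sum.swap)
  also have "\<dots> = card (cells mu)" by simp
  finally show ?thesis using card_cells[OF assms] by simp
qed

text \<open>Strict columns contain no entry twice, so the cells with a given entry can be counted by
  their columns.\<close>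

lemma inj_on_snd_ssyt:
  assumes "T \<in> ssyt mu"
  shows "inj_on snd {p\<in>cells mu. T p = i}"
proof (rule inj_onI)
  have column: "T (r, c) < T (r', c)" if "(r, c) \<in> cells mu" "(r', c) \<in> cells mu" "r < r'" for r r' c
    using assms that unfolding ssyt_def by blast
  fix p q assume "p \<in> {p\<in>cells mu. T p = i}" "q \<in> {p\<in>cells mu. T p = i}" "snd p = snd q"
  then show "p = q"
    using column[of "fst p" "snd p" "fst q"] column[of "fst q" "snd p" "fst p"]
    by (cases p; cases q; cases "fst p" "fst q" rule: linorder_cases) auto
qed

text \<open>Each of the \<open>mu 0\<close> columns contains \<open>i\<close> at most once.\<close>

lemma tableau_weight_le:
  assumes "T \<in> ssyt mu" "is_partition m mu"
  shows "Poly_Mapping.lookup (tableau_weight mu T) i \<le> mu 0"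
proof -
  have "inj_on snd {p\<in>cells mu. T p = i}"
    by (rule inj_on_snd_ssyt[OF assms(1)])
  moreover have "snd ` {p\<in>cells mu. T p = i} \<subseteq> {..<mu 0}"
    using is_partition_antimonoD[OF assms(2), of 0] by (auto simp: mem_cells intro: less_le_trans)
  ultimately have "card {p\<in>cells mu. T p = i} \<le> card {..<mu 0}"
    by (rule card_inj_on_le) simp
  then show ?thesis
    by (simp add: lookup_tableau_weight finite_cells[OF assms(2)])
qed

text \<open>The key tableau: column \<open>c\<close> consists of all \<open>i\<close> whose exponent exceeds \<open>c\<close>, and the rows
  are weakly increasing because these sets shrink with \<open>c\<close>.\<close>

lemma ssyt_of_permuted_weight:
  fixes \<sigma> :: "'m::{finite,linorder} \<Rightarrow> nat"
  assumes part: "is_partition CARD('m) mu" and \<sigma>: "bij_betw \<sigma> UNIV {..<CARD('m)}"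
  shows "\<exists>T\<in>ssyt mu. \<forall>i. Poly_Mapping.lookup (tableau_weight mu T) i = mu (\<sigma> i)"
proof -
  define S where "S c = {i. c < mu (\<sigma> i)}" for c
  define T where "T = (\<lambda>p. if p \<in> cells mu then sorted_list_of_set (S (snd p)) ! fst p else undefined)"
  \<comment> \<open>\<open>card (S c)\<close> is the height of column \<open>c\<close>:
    \<open>\<sigma>\<close> maps \<open>S c\<close> bijectively onto the rows longer than
    \<open>c\<close>, and these form an initial segment.\<close>
  have cell: "c < mu r \<longleftrightarrow> r < card (S c)" for r c
  proof -
    have "\<sigma> ` S c = {r. c < mu r}"
    proof (intro equalityI subsetI)
      fix r assume "r \<in> {r. c < mu r}"
      then have r: "c < mu r" by simp
      then have "r \<in> \<sigma> ` UNIV"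
        using is_partition_pos_row[OF part] \<sigma> by (simp add: bij_betw_def)
      then show "r \<in> \<sigma> ` S c" using r by (auto simp: S_def)
    qed (auto simp: S_def)
    moreover have "inj_on \<sigma> (S c)"
      using \<sigma> by (auto simp: bij_betw_def intro: inj_on_subset)
    ultimately have card: "card {r. c < mu r} = card (S c)"
      by (metis card_image)
    have fin: "finite {r. c < mu r}"
      using is_partition_pos_row[OF part] by (auto intro: finite_subset[of _ "{..<CARD('m)}"])
    show ?thesis
    proof
      assume c: "c < mu r"
      have "{..r} \<subseteq> {r. c < mu r}"
      proof
        fix s assume "s \<in> {..r}"
        then show "s \<in> {r. c < mu r}"
          using is_partition_antimonoD[OF part, of s r] c by simp
      qed
      from card_mono[OF fin this] show "r < card (S c)" using card by simp
    next
      assume r: "r < card (S c)"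
      show "c < mu r"
      proof (rule ccontr)
        assume c: "\<not> c < mu r"
        have "{r. c < mu r} \<subseteq> {..<r}"
        proof
          fix s assume "s \<in> {r. c < mu r}"
          then show "s \<in> {..<r}"
            using is_partition_antimonoD[OF part, of r s] c by fastforce
        qed
        from card_mono[OF finite_lessThan this] show False using card r by simp
      qed
    qed
  qed
  have "T \<in> ssyt mu"
    unfolding ssyt_def
  proof (intro CollectI conjI allI impI)
    show "T \<in> cells mu \<rightarrow>\<^sub>E UNIV" by (auto simp: T_def)
    show "T (r, c) \<le> T (r, c')"
      if "(r, c) \<in> cells mu \<and> (r, c') \<in> cells mu \<and> c < c'" for r c c'
    proof -
      have "S c' \<subseteq> S c" using that by (auto simp: S_def)
      then show ?thesis
        using that sorted_list_of_set_nth_le[of "S c" "S c'" r] cell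
        by (simp add: T_def mem_cells)
    qed
    show "T (r, c) < T (r', c)"
      if "(r, c) \<in> cells mu \<and> (r', c) \<in> cells mu \<and> r < r'" for r r' c
    proof -
      have "sorted_wrt (<) (sorted_list_of_set (S c))" by simp
      then show ?thesis
        using that cell sorted_wrt_nth_less[of "(<)" "sorted_list_of_set (S c)" r r']
        by (simp add: T_def mem_cells)
    qed
  qed
  moreover have "card {p\<in>cells mu. T p = i} = mu (\<sigma> i)" for i
  proof -
    \<comment> \<open>The entry \<open>i\<close> occurs exactly in the columns \<open>c\<close> with
      \<open>i \<in> S c\<close>, which are the first \<open>mu (\<sigma> i)\<close>
      columns.\<close>
    have "bij_betw snd {p\<in>cells mu. T p = i} {..<mu (\<sigma> i)}"
      unfolding bij_betw_def
    proof
      show "inj_on snd {p\<in>cells mu. T p = i}"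
        by (rule inj_on_snd_ssyt) fact
      show "snd ` {p\<in>cells mu. T p = i} = {..<mu (\<sigma> i)}"
      proof (intro equalityI subsetI)
        fix c assume "c \<in> snd ` {p\<in>cells mu. T p = i}"
        then obtain r where r: "(r, c) \<in> cells mu" "T (r, c) = i" by auto
        then have "i = sorted_list_of_set (S c) ! r" "r < card (S c)"
          using cell by (auto simp: T_def mem_cells)
        then have "i \<in> S c"
          by (metis finite length_sorted_list_of_set nth_mem set_sorted_list_of_set)
        then show "c \<in> {..<mu (\<sigma> i)}" by (simp add: S_def)
      next
        fix c assume "c \<in> {..<mu (\<sigma> i)}"
        then have "i \<in> set (sorted_list_of_set (S c))" by (simp add: S_def)
        then obtain r where "r < card (S c)" "sorted_list_of_set (S c) ! r = i"
          by (metis in_set_conv_nth length_sorted_list_of_set)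
        then have "(r, c) \<in> {p\<in>cells mu. T p = i}"
          using cell by (simp add: T_def mem_cells)
        then show "c \<in> snd ` {p\<in>cells mu. T p = i}" by force
      qed
    qed
    then show ?thesis by (simp add: bij_betw_same_card)
  qed
  ultimately show ?thesis
    using lookup_tableau_weight[OF finite_cells[OF part]] by metis
qed

section \<open>The support of \<open>G_poly\<close>\<close>

lemma lookup_of_nat_mult:
  fixes f :: "'a::comm_monoid_add \<Rightarrow>\<^sub>0 int"
  shows "Poly_Mapping.lookup (of_nat n * f) k = int n * Poly_Mapping.lookup f k"
  by (induction n) (simp_all add: distrib_right lookup_add)

lemma lookup_sign_mult:
  fixes f :: "'a::comm_monoid_add \<Rightarrow>\<^sub>0 int"
  shows "Poly_Mapping.lookup ((- 1) ^ n * f) k = (- 1) ^ n * Poly_Mapping.lookup f k"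
  by (cases "even n") simp_all

lemma lookup_G_poly:
  "Poly_Mapping.lookup (G_poly h lam :: 'm::{finite,linorder} int_mpoly) \<alpha> =
    (\<Sum>mu\<in>A_set CARD('m) h lam. (- 1) ^ card (skew_cells lam mu) *
      (int (b_coeff h lam mu) * Poly_Mapping.lookup (schur mu :: 'm int_mpoly) \<alpha>))"
  unfolding G_poly_def lookup_sum mult.assoc lookup_sign_mult lookup_of_nat_mult ..

text \<open>No cancellation: the sign of \<open>s\<^sub>\<mu>\<close> in \<open>G\<^sub>h\<^sub>,\<^sub>\<lambda>\<close> depends on the degree only.\<close>

lemma keys_G_poly:
  assumes "h \<ge> 1"
  shows "Poly_Mapping.keys (G_poly h lam :: 'm::{finite,linorder} int_mpoly) =
    (\<Union>mu\<in>A_set CARD('m) h lam. Poly_Mapping.keys (schur mu :: 'm int_mpoly))"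
proof (intro equalityI subsetI)
  fix \<alpha> assume "\<alpha> \<in> Poly_Mapping.keys (G_poly h lam :: 'm int_mpoly)"
  then have "Poly_Mapping.lookup (G_poly h lam :: 'm int_mpoly) \<alpha> \<noteq> 0"
    by (simp add: in_keys_iff)
  then obtain mu where "mu \<in> A_set CARD('m) h lam"
    "Poly_Mapping.lookup (schur mu :: 'm int_mpoly) \<alpha> \<noteq> 0"
    unfolding lookup_G_poly by (metis (no_types, lifting) mult_zero_right sum.neutral)
  then show "\<alpha> \<in> (\<Union>mu\<in>A_set CARD('m) h lam. Poly_Mapping.keys (schur mu :: 'm int_mpoly))"
    by (auto simp: in_keys_iff)
next
  fix \<alpha> assume "\<alpha> \<in> (\<Union>mu\<in>A_set CARD('m) h lam. Poly_Mapping.keys (schur mu :: 'm int_mpoly))"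
  then obtain nu where nu: "nu \<in> A_set CARD('m) h lam" "\<alpha> \<in> Poly_Mapping.keys (schur nu :: 'm int_mpoly)"
    by blast
  \<comment> \<open>The degree of \<open>\<alpha>\<close> above that of \<open>lam\<close>; it fixes
    the sign of every contribution to the coefficient of \<open>\<alpha>\<close>.\<close>
  define d where "d = (\<Sum>i\<in>UNIV. Poly_Mapping.lookup \<alpha> i) - part_size CARD('m) lam"
  define t where "t mu = int (b_coeff h lam mu) * Poly_Mapping.lookup (schur mu :: 'm int_mpoly) \<alpha>" for mu
  have pos: "t mu \<ge> 0" if "mu \<in> A_set CARD('m) h lam" for mu
    using that lookup_schur[OF finite_cells, of "CARD('m)" mu \<alpha>] by (simp add: t_def A_set_def)
  \<comment> \<open>If \<open>\<alpha>\<close> occurs in \<open>schur mu\<close>, homogeneity gives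
    the exponent \<open>d\<close>; if not, \<open>t mu = 0\<close> and the sign is
    immaterial.\<close>
  have sign: "(- 1) ^ card (skew_cells lam mu) * t mu = (- 1) ^ d * t mu"
    if "mu \<in> A_set CARD('m) h lam" for mu
  proof (cases "\<alpha> \<in> Poly_Mapping.keys (schur mu :: 'm int_mpoly)")
    case True
    have mu: "is_partition CARD('m) mu" "lam \<le> mu" using that by (auto simp: A_set_def)
    obtain T :: "nat \<times> nat \<Rightarrow> 'm" where "\<alpha> = tableau_weight mu T"
      using True keys_schur[OF finite_cells[OF mu(1)]] by blast
    then have "d = card (skew_cells lam mu)"
      using sum_tableau_weight[OF mu(1), of T] card_skew_cells[OF mu] by (simp add: d_def)
    then show ?thesis by simp
  next
    case False
    then show ?thesis by (simp add: t_def in_keys_iff)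
  qed
  have "t nu \<noteq> 0" using nu by (simp add: t_def in_keys_iff A_set_def)
  then have "0 < t nu" using pos[OF nu(1)] by simp
  also have "t nu \<le> (\<Sum>mu\<in>A_set CARD('m) h lam. t mu)"
    using nu pos finite_A_set[OF assms] by (intro member_le_sum) auto
  finally have "(- 1) ^ d * (\<Sum>mu\<in>A_set CARD('m) h lam. t mu) \<noteq> 0" by simp
  also have "(- 1) ^ d * (\<Sum>mu\<in>A_set CARD('m) h lam. t mu) =
      Poly_Mapping.lookup (G_poly h lam :: 'm int_mpoly) \<alpha>"
    unfolding lookup_G_poly t_def[symmetric] sum_distrib_left by (intro sum.cong) (auto simp: sign)
  finally show "\<alpha> \<in> Poly_Mapping.keys (G_poly h lam :: 'm int_mpoly)"
    by (simp add: in_keys_iff)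
qed


section \<open>Hyperplanes and the polytope of a Schur polynomial\<close>

lemma affine_coord_sum:
  "affine {x :: real ^ 'm::finite. (\<Sum>i\<in>I. x $ i) = c}"
  unfolding affine_def
  by (auto simp: sum.distrib simp flip: sum_distrib_left distrib_right)

lemma linear_coord_sum: "linear (\<lambda>x :: real ^ 'm::finite. \<Sum>i\<in>I. x $ i)"
  by (intro linearI) (simp_all add: sum.distrib sum_distrib_left)

lemma convex_coord_le: "convex {x :: real ^ 'm::finite. x $ i \<le> c}"
proof -
  have "{x :: real ^ 'm. x $ i \<le> c} = {x. axis i 1 \<bullet> x \<le> c}"
    by (simp add: inner_axis')
  then show ?thesis by (simp add: convex_halfspace_le)
qed

text \<open>The affine hull of \<open>S\<close> still satisfies the equation that \<open>q\<close>
  violates. Dimensions are counted below by adding such points one at a time.\<close>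

lemma aff_dim_insert_coord_sum:
  fixes S :: "(real ^ 'm::finite) set"
  assumes "\<And>x. x \<in> S \<Longrightarrow> (\<Sum>i\<in>I. x $ i) = c" "(\<Sum>i\<in>I. q $ i) \<noteq> c"
  shows "aff_dim (insert q S) = aff_dim S + 1"
proof -
  have "affine hull S \<subseteq> {x. (\<Sum>i\<in>I. x $ i) = c}"
    using assms(1) by (intro hull_minimal affine_coord_sum) auto
  then have "q \<notin> affine hull S" using assms(2) by blast
  then show ?thesis by (simp add: aff_dim_insert)
qed

text \<open>A nonzero linear map is not constant, so \<open>H\<close> is a proper affine
  subspace.\<close>

lemma isolates_imp_aff_dim_le:
  fixes H :: "(real ^ 'm::finite) set"
  assumes "isolates H S"
  shows "aff_dim H \<le> int CARD('m) - 1"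
proof -
  obtain f a where f: "linear f" "f \<noteq> (\<lambda>_. 0)" "H = {x. f x = (a::real)}"
    using assms unfolding isolates_def by blast
  have "affine H"
    using f(1) unfolding affine_def f(3)
    by (auto simp: linear_add linear_cmul simp flip: distrib_right)
  moreover have "H \<noteq> UNIV"
  proof
    assume "H = UNIV"
    then have "{x. f x = a} = UNIV" using f(3) by simp
    then have "f x = f 0" for x by (metis UNIV_I mem_Collect_eq)
    then show False using f(1,2) by (auto simp: linear_0 fun_eq_iff)
  qed
  ultimately have "aff_dim H \<noteq> int DIM(real ^ 'm)"
    by (metis aff_dim_eq_full affine_hull_eq)
  then show ?thesis using aff_dim_le_DIM[of H] by simp
qed

text \<open>The segment between the two points would cross the hyperplane.\<close>

lemma isolates_not_both_sides:
  fixes g :: "real ^ 'm \<Rightarrow> real"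
  assumes "isolates {x. g x = c} S" "linear g" "u \<in> S" "v \<in> S" "g u < c"
  shows "g v \<le> c"
proof (rule ccontr)
  assume "\<not> g v \<le> c"
  then have v: "c < g v" by simp
  \<comment> \<open>The equation \<open>f x = a\<close> may differ from \<open>g x = c\<close>; only
    the solution sets are known to agree.\<close>
  obtain f a where f: "linear f" "{x. g x = c} = {x. f x = (a::real)}"
      "S \<subseteq> {x. f x \<ge> a} \<or> S \<subseteq> {x. f x \<le> a}"
    using assms(1) unfolding isolates_def by blast
  define s where "s = (c - g u) / (g v - g u)"
  have s: "0 < s" "s < 1" using assms(5) v by (auto simp: s_def field_simps)
  define w where "w = u + s *\<^sub>R (v - u)"
  have "g w = g u + s * (g v - g u)"
    using assms(2) by (simp add: w_def linear_add linear_diff linear_cmul)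
  then have "g w = c" using assms(5) v by (simp add: s_def)
  then have "f w = a" using f(2) by blast
  moreover have "f w = f u + s * (f v - f u)"
    using f(1) by (simp add: w_def linear_add linear_diff linear_cmul)
  \<comment> \<open>A positive combination of \<open>f u - a\<close> and \<open>f v - a\<close>,
    which do not have opposite signs, vanishes; so both are 0, and \<open>u\<close> would lie on the
    hyperplane.\<close>
  ultimately have eq: "(1 - s) * (f u - a) + s * (f v - a) = 0"
    by (simp add: algebra_simps)
  have "f u = a"
  proof (rule ccontr)
    assume "f u \<noteq> a"
    then have "f u > a \<and> f v \<ge> a \<or> f u < a \<and> f v \<le> a"
      using f(3) assms(3,4) by force
    then show False
    proof
      assume "f u > a \<and> f v \<ge> a"
      then have "(1 - s) * (f u - a) > 0" "s * (f v - a) \<ge> 0" using s by auto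
      then show False using eq by linarith
    next
      assume "f u < a \<and> f v \<le> a"
      then have "(1 - s) * (f u - a) < 0" "s * (f v - a) \<le> 0"
        using s by (auto simp: mult_less_0_iff mult_le_0_iff)
      then show False using eq by linarith
    qed
  qed
  then have "g u = c" using f(2) by blast
  then show False using assms(5) by simp
qed

section \<open>Points of the Schur polytope\<close>

lemma permuted_mem_newton_polytope_schur:
  fixes \<sigma> :: "'m::{finite,linorder} \<Rightarrow> nat"
  assumes "is_partition CARD('m) mu" "bij_betw \<sigma> UNIV {..<CARD('m)}"
  shows "(\<chi> i. real (mu (\<sigma> i))) \<in> newton_polytope (schur mu :: 'm int_mpoly)"
proof -
  obtain T where "T \<in> ssyt mu" "\<And>i. Poly_Mapping.lookup (tableau_weight mu T) i = mu (\<sigma> i)"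
    using ssyt_of_permuted_weight[OF assms] by blast
  then show ?thesis
    unfolding newton_polytope_def keys_schur[OF finite_cells[OF assms(1)]]
    by (intro hull_inc image_eqI[of _ _ "tableau_weight mu T"]) auto
qed

lemma newton_polytope_schur_sum:
  fixes x :: "real ^ 'm::{finite,linorder}"
  assumes "is_partition CARD('m) mu" "x \<in> newton_polytope (schur mu)"
  shows "(\<Sum>i\<in>UNIV. x $ i) = real (part_size CARD('m) mu)"
proof -
  have "newton_polytope (schur mu) \<subseteq> {x :: real ^ 'm::{finite,linorder}. (\<Sum>i\<in>UNIV. x $ i) = real (part_size CARD('m) mu)}"
    unfolding newton_polytope_def keys_schur[OF finite_cells[OF assms(1)]]
    by (intro hull_minimal affine_imp_convex affine_coord_sum)
      (auto simp: sum_tableau_weight[OF assms(1)] simp flip: of_nat_sum)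
  then show ?thesis using assms(2) by blast
qed

lemma newton_polytope_schur_le:
  fixes x :: "real ^ 'm::{finite,linorder}"
  assumes "is_partition CARD('m) mu" "x \<in> newton_polytope (schur mu)"
  shows "x $ i \<le> real (mu 0)"
proof -
  have "newton_polytope (schur mu) \<subseteq> {x :: real ^ 'm::{finite,linorder}. x $ i \<le> real (mu 0)}"
    unfolding newton_polytope_def keys_schur[OF finite_cells[OF assms(1)]]
    by (intro hull_minimal convex_coord_le) (auto simp: tableau_weight_le[OF _ assms(1)])
  then show ?thesis using assms(2) by blast
qed

lemma newton_polytope_schur_subset:
  assumes "h \<ge> 1" "mu \<in> A_set CARD('m) h lam"
  shows "newton_polytope (schur mu :: 'm::{finite,linorder} int_mpoly) \<subseteq> newton_polytope (G_poly h lam)"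
  unfolding newton_polytope_def keys_G_poly[OF assms(1)]
  using assms(2) by (intro hull_mono) auto

text \<open>A numbering of the variables that starts with \<open>I\<close>. Permuting a partition
  along it puts its largest parts on \<open>I\<close>.\<close>

lemma ex_bij_betw_prefix:
  fixes I :: "'m::finite set"
  shows "\<exists>\<sigma>. bij_betw \<sigma> UNIV {..<CARD('m)} \<and> \<sigma> ` I = {..<card I}"
proof -
  have le: "card I \<le> CARD('m)" by (simp add: card_mono)
  obtain f where f: "bij_betw f I {..<card I}"
    using finite_same_card_bij[of I "{..<card I}"] by auto
  obtain g where g: "bij_betw g (- I) {card I..<CARD('m)}"
    using finite_same_card_bij[of "- I" "{card I..<CARD('m)}"] by (auto simp: Compl_eq_Diff_UNIV card_Diff_subset)
  have "bij_betw (\<lambda>i. if i \<in> I then f i else g i) (I \<union> - I) ({..<card I} \<union> {card I..<CARD('m)})"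
    by (rule bij_betw_disjoint_Un[OF f g]) auto
  moreover have "{..<card I} \<union> {card I..<CARD('m)} = {..<CARD('m)}" using le by auto
  moreover have "(\<lambda>i. if i \<in> I then f i else g i) ` I = {..<card I}"
    using f by (auto simp: bij_betw_def)
  ultimately show ?thesis by (metis Compl_partition)
qed

lemma ex_bij_betw_ends:
  fixes i j :: "'m::finite"
  assumes "i \<noteq> j"
  shows "\<exists>\<sigma>. bij_betw \<sigma> UNIV {..<CARD('m)} \<and> \<sigma> i = 0 \<and> \<sigma> j = CARD('m) - 1"
proof -
  obtain \<sigma> where \<sigma>: "bij_betw \<sigma> UNIV {..<CARD('m)}" "\<sigma> ` (- {j}) = {..<card (- {j})}"
    using ex_bij_betw_prefix by blast
  have "card (- {j}) = CARD('m) - 1" by (simp add: Compl_eq_Diff_UNIV card_Diff_subset)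
  moreover have "0 < CARD('m) - 1"
    using assms card_mono[of UNIV "{i, j}"] by simp
  ultimately have "0 \<in> \<sigma> ` (- {j})" using \<sigma>(2) by (metis lessThan_iff)
  then obtain a where a: "a \<noteq> j" "\<sigma> a = 0" by force
  \<comment> \<open>\<open>\<sigma>\<close> already puts \<open>j\<close> last; the swap gives the
    number 0 of \<open>a\<close> to \<open>i\<close> and leaves \<open>j\<close> alone.\<close>
  let ?\<tau> = "\<sigma> \<circ> Transposition.transpose a i"
  have "bij_betw ?\<tau> UNIV {..<CARD('m)}"
    using \<sigma>(1) by (intro bij_betw_trans[of _ _ UNIV]) auto
  moreover have "?\<tau> i = 0" using a by simp
  moreover have "?\<tau> j = CARD('m) - 1"
  proof -
    have "\<sigma> j \<notin> \<sigma> ` (- {j})" using \<sigma>(1) by (auto simp: bij_betw_def inj_on_def)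
    moreover have "\<sigma> j < CARD('m)" using \<sigma>(1) by (auto simp: bij_betw_def)
    ultimately have "\<sigma> j = CARD('m) - 1" using \<sigma>(2) by (simp add: Compl_eq_Diff_UNIV card_Diff_subset)
    then show ?thesis using a assms by (simp add: transpose_apply_other)
  qed
  ultimately show ?thesis by blast
qed

text \<open>Translates the two coordinate sums that may define \<open>H\<close> into sums over the
  first and the last rows of a partition.\<close>

lemma coord_sum_permuted:
  fixes \<sigma> :: "'m::finite \<Rightarrow> nat"
  assumes "bij_betw \<sigma> UNIV {..<CARD('m)}" "\<sigma> ` I = {..<card I}"
  shows "(\<Sum>i\<in>I. (\<chi> i. real (mu (\<sigma> i))) $ i) = real (\<Sum>r<card I. mu r)"
    and "(\<Sum>i\<in>- I. (\<chi> i. real (mu (\<sigma> i))) $ i) = real (\<Sum>r=card I..<CARD('m). mu r)"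
proof -
  have inj: "inj \<sigma>" using assms(1) by (simp add: bij_betw_def)
  have "\<sigma> ` (- I) = {..<CARD('m)} - {..<card I}"
    using assms inj by (metis Compl_eq_Diff_UNIV bij_betw_def image_set_diff)
  then have image: "\<sigma> ` (- I) = {card I..<CARD('m)}" by auto
  show "(\<Sum>i\<in>I. (\<chi> i. real (mu (\<sigma> i))) $ i) = real (\<Sum>r<card I. mu r)"
    unfolding assms(2)[symmetric] using inj_on_subset[OF inj]
    by (simp add: sum.reindex)
  show "(\<Sum>i\<in>- I. (\<chi> i. real (mu (\<sigma> i))) $ i) = real (\<Sum>r=card I..<CARD('m). mu r)"
    unfolding image[symmetric] using inj_on_subset[OF inj]
    by (simp add: sum.reindex)
qed

text \<open>Exchange the largest part, placed on \<open>I\<close>, with the smallest, placed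
  outside. The point obtained will tell on which side of \<open>H\<close> the polytope lies.\<close>

lemma ex_newton_polytope_schur_less:
  fixes I :: "'m::{finite,linorder} set"
  assumes part: "is_partition CARD('m) mu" and less: "mu (CARD('m) - 1) < mu 0"
    and I: "I \<noteq> {}" "I \<noteq> UNIV"
  shows "\<exists>x\<in>newton_polytope (schur mu). (\<Sum>i\<in>I. x $ i) < real (\<Sum>r<card I. mu r)"
proof -
  obtain \<sigma> where \<sigma>: "bij_betw \<sigma> UNIV {..<CARD('m)}" "\<sigma> ` I = {..<card I}"
    using ex_bij_betw_prefix by blast
  have card: "0 < card I" "card I < CARD('m)"
    using I by (auto simp: card_gt_0_iff intro: psubset_card_mono)
  then have "0 \<in> \<sigma> ` I" using \<sigma> by simp
  then obtain i where i: "i \<in> I" "\<sigma> i = 0" by auto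
  have "CARD('m) - 1 \<in> \<sigma> ` UNIV" using \<sigma>(1) card by (simp add: bij_betw_def)
  then obtain j where j: "\<sigma> j = CARD('m) - 1" by auto
  have jI: "j \<notin> I"
  proof
    assume "j \<in> I"
    then have "\<sigma> j < card I" using \<sigma>(2) by auto
    then show False using j card by simp
  qed
  let ?\<tau> = "\<sigma> \<circ> Transposition.transpose i j"
  let ?x = "(\<chi> k. real (mu (?\<tau> k))) :: real ^ 'm::{finite,linorder}"
  have "bij_betw ?\<tau> UNIV {..<CARD('m)}"
    using \<sigma>(1) by (intro bij_betw_trans[of _ _ UNIV]) auto
  then have "?x \<in> newton_polytope (schur mu)"
    by (rule permuted_mem_newton_polytope_schur[OF part])
  moreover have "(\<Sum>k\<in>I. ?x $ k) < (\<Sum>k\<in>I. (\<chi> k. real (mu (\<sigma> k))) $ k)"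
  proof (rule sum_strict_mono_ex1)
    show "\<forall>k\<in>I. ?x $ k \<le> (\<chi> k. real (mu (\<sigma> k))) $ k"
    proof
      fix k assume "k \<in> I"
      then have "k \<noteq> j" using jI by auto
      then show "?x $ k \<le> (\<chi> k. real (mu (\<sigma> k))) $ k"
        using less i j jI by (cases "k = i") (auto simp: transpose_apply_other)
    qed
    show "\<exists>k\<in>I. ?x $ k < (\<chi> k. real (mu (\<sigma> k))) $ k"
      using less i j by (intro bexI[of _ i]) auto
  qed simp
  ultimately show ?thesis
    unfolding coord_sum_permuted(1)[OF \<sigma>, of mu] by blast
qed

text \<open>Exchanging the largest and the smallest part shows that the directions of the polytope
  contain all differences of unit vectors.\<close>

lemma aff_dim_newton_polytope_schur:
  assumes part: "is_partition CARD('m) mu" and less: "mu (CARD('m) - 1) < mu 0"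
  shows "int CARD('m) - 1 \<le> aff_dim (newton_polytope (schur mu :: 'm::{finite,linorder} int_mpoly))"
proof -
  let ?P = "newton_polytope (schur mu :: 'm int_mpoly)"
  obtain \<sigma>0 :: "'m \<Rightarrow> nat" where "bij_betw \<sigma>0 UNIV {..<CARD('m)}"
    using ex_bij_betw_prefix by blast
  then obtain p where p: "p \<in> ?P" using permuted_mem_newton_polytope_schur[OF part] by blast
  define D where "D = (\<lambda>x. x - p) ` ?P"
  have dim: "aff_dim ?P = int (dim D)"
    unfolding D_def using p by (intro aff_dim_eq_dim_subtract hull_inc)
  have diff: "axis i 1 - axis j 1 \<in> span D" if ij: "i \<noteq> j" for i j :: 'm
  proof -
    obtain \<sigma> where \<sigma>: "bij_betw \<sigma> UNIV {..<CARD('m)}" "\<sigma> i = 0" "\<sigma> j = CARD('m) - 1"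
      using ex_bij_betw_ends[OF ij] by blast
    let ?\<tau> = "\<sigma> \<circ> Transposition.transpose i j"
    let ?x = "(\<chi> k. real (mu (\<sigma> k))) :: real ^ 'm::{finite,linorder}" and ?y = "(\<chi> k. real (mu (?\<tau> k))) :: real ^ 'm::{finite,linorder}"
    have "bij_betw ?\<tau> UNIV {..<CARD('m)}"
      using \<sigma>(1) by (intro bij_betw_trans[of _ _ UNIV]) auto
    then have "?y \<in> ?P" by (rule permuted_mem_newton_polytope_schur[OF part])
    moreover have "?x \<in> ?P" by (rule permuted_mem_newton_polytope_schur[OF part \<sigma>(1)])
    ultimately have "(?x - p) - (?y - p) \<in> span D"
      unfolding D_def by (intro span_diff span_base imageI)
    then have "inverse (real (mu 0) - real (mu (CARD('m) - 1))) *\<^sub>R (?x - ?y) \<in> span D"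
      by (intro span_mul) simp
    \<comment> \<open>The two points differ only in the coordinates \<open>i\<close> and
      \<open>j\<close>, where the largest and the smallest part are exchanged.\<close>
    moreover have "?x - ?y = (real (mu 0) - real (mu (CARD('m) - 1))) *\<^sub>R (axis i 1 - axis j 1)"
      using ij \<sigma>(2,3)
      by (auto simp: vec_eq_iff axis_def Transposition.transpose_def)
    ultimately show ?thesis using less by simp
  qed
  fix i0 :: 'm
  \<comment> \<open>The differences together with a single unit vector give all unit vectors, so
    \<open>D\<close> misses at most one dimension.\<close>
  have "span (insert (axis i0 1) D) = UNIV"
  proof -
    have "axis i 1 \<in> span (insert (axis i0 1) D)" for i
    proof (cases "i = i0")
      case True
      then show ?thesis by (auto intro: span_base)
    next
      case False
      have "span D \<subseteq> span (insert (axis i0 1) D)" by (intro span_mono) auto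
      then have "(axis i 1 - axis i0 1) + axis i0 1 \<in> span (insert (axis i0 1) D)"
        using diff[OF False] by (intro span_add) (auto intro: span_base)
      then show ?thesis by simp
    qed
    then have "Basis \<subseteq> span (insert (axis i0 1) D)"
      by (auto simp: Basis_vec_def)
    then show ?thesis by (metis span_Basis span_minimal subspace_span top.extremum_uniqueI)
  qed
  then have "dim (insert (axis i0 1) D) = CARD('m)"
    by (metis DIM_cart DIM_real dim_UNIV dim_span mult.right_neutral)
  moreover have "dim (insert (axis i0 1) D) \<le> dim D + 1"
    by (simp add: dim_insert)
  ultimately show ?thesis using dim by linarith
qed


section \<open>Moving one box\<close>

lemma remove_box_mem_A_set:
  assumes "h \<ge> 1" "mu \<in> A_set m h lam" "lam r < mu r" "mu (Suc r) < mu r"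
  shows "mu(r := mu r - 1) \<in> A_set m h lam"
proof -
  have mu: "is_partition m mu" "lam \<le> mu" "\<And>r. mu r \<le> lam r + h * r"
    using assms(1,2) mem_A_set_iff by auto
  have "(mu(r := mu r - 1)) s \<le> lam s + h * s" for s
    using mu(3)[of s] by auto
  moreover have "lam \<le> mu(r := mu r - 1)"
    using mu(2) assms(3) by (auto simp: le_fun_def)
  ultimately show ?thesis
    using is_partition_remove_box[OF mu(1) assms(4)] mem_A_set_iff[OF assms(1)] by blast
qed

lemma sum_add_box:
  fixes mu :: "nat \<Rightarrow> nat"
  assumes "finite A"
  shows "sum (mu(r := Suc (mu r))) A = sum mu A + (if r \<in> A then 1 else 0)"
proof (cases "r \<in> A")
  case True
  then show ?thesis using assms by (simp add: sum.remove[of A r])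
next
  case False
  then have "sum (mu(r := Suc (mu r))) A = sum mu A" by (intro sum.cong) auto
  then show ?thesis using False by simp
qed

lemma sum_remove_box:
  fixes mu :: "nat \<Rightarrow> nat"
  assumes "finite A" "0 < mu r"
  shows "sum (mu(r := mu r - 1)) A + (if r \<in> A then 1 else 0) = sum mu A"
  using sum_add_box[OF assms(1), of "mu(r := mu r - 1)" r] assms(2) by simp

text \<open>If the last part is positive, a box is removed from it: \<open>lam\<close> has no box
  there, and the row lies outside the head because \<open>t < m\<close>. Otherwise a box is added in
  the first empty row.\<close>

lemma ex_A_set_same_head:
  assumes h: "h \<ge> 1" and lam: "lam (m - 1) = 0" and mu: "mu \<in> A_set m h lam"
    and less: "mu (m - 1) < mu 0" and t: "t < m"
    and max: "\<And>nu. nu \<in> A_set m h lam \<Longrightarrow> sum nu {..<t} \<le> sum mu {..<t}"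
  shows "\<exists>nu\<in>A_set m h lam. part_size m nu \<noteq> part_size m mu \<and> sum nu {..<t} = sum mu {..<t}"
proof (cases "mu (m - 1) = 0")
  case False
  have part: "is_partition m mu" using mu by (simp add: A_set_def)
  let ?nu = "mu(m - 1 := mu (m - 1) - 1)"
  have "mu (Suc (m - 1)) < mu (m - 1)"
    using False t part by (simp add: is_partition_def)
  then have "?nu \<in> A_set m h lam"
    using False lam by (intro remove_box_mem_A_set[OF h mu]) auto
  moreover have "part_size m ?nu \<noteq> part_size m mu"
    using sum_remove_box[of "{..<m}" mu "m - 1"] False t by (simp add: part_size_def)
  moreover have "sum ?nu {..<t} = sum mu {..<t}"
    using sum_remove_box[of "{..<t}" mu "m - 1"] False t by (simp split: if_splits)
  ultimately show ?thesis by blast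
next
  case True
  have part: "is_partition m mu" and le: "lam \<le> mu" using mu by (auto simp: A_set_def)
  define r where "r = (LEAST r. mu r = 0)"
  have r0: "mu r = 0" unfolding r_def using True by (rule LeastI)
  have "r \<le> m - 1" unfolding r_def using True by (rule Least_le)
  have rpos: "0 < r" using less r0 by (cases r) auto
  then have "mu (r - 1) \<noteq> 0"
    using not_less_Least[of "r - 1" "\<lambda>r. mu r = 0"] by (simp add: r_def[symmetric])
  moreover have "r < m" using \<open>r \<le> m - 1\<close> t by simp
  ultimately have "is_partition m (mu(r := Suc (mu r)))"
    using r0 by (intro is_partition_add_box[OF part]) auto
  \<comment> \<open>As \<open>r\<close> is positive, \<open>h * r \<ge> 1\<close> leaves room for
    one box.\<close>
  then have add: "addable_row m h lam mu r"
    using r0 h rpos \<open>r < m\<close> by (simp add: addable_row_def)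
  let ?nu = "mu(r := Suc (mu r))"
  have nu: "?nu \<in> A_set m h lam" by (rule add_box_mem_A_set[OF h mu add])
  moreover have "part_size m ?nu \<noteq> part_size m mu"
    using part_size_add_box[OF \<open>r < m\<close>, of mu] by simp
  \<comment> \<open>By \<open>max\<close> the new box lies outside the head, since otherwise the
    head sum would grow.\<close>
  moreover have "sum ?nu {..<t} = sum mu {..<t}"
    using max[OF nu] sum_add_box[of "{..<t}" mu r] by (simp split: if_splits)
  ultimately show ?thesis by blast
qed

text \<open>If \<open>mu\<close> has a box outside \<open>lam\<close>, such a box is removed, and
  minimality keeps it out of the tail. For \<open>mu = lam\<close> a box is added at an inner corner
  of the head, below the top row.\<close>

lemma ex_A_set_same_tail:
  assumes h: "h \<ge> 1" and lam: "is_partition m lam" and mu: "mu \<in> A_set m h lam" and t: "t < m"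
    and min: "\<And>nu. nu \<in> A_set m h lam \<Longrightarrow> sum mu {t..<m} \<le> sum nu {t..<m}"
    and ne: "mu \<noteq> lam \<or> (\<exists>r. 0 < r \<and> r < t \<and> lam r < lam (r - 1))"
  shows "\<exists>nu\<in>A_set m h lam. part_size m nu \<noteq> part_size m mu \<and> sum nu {t..<m} = sum mu {t..<m}"
proof (cases "mu = lam")
  case False
  have part: "is_partition m mu" and le: "lam \<le> mu" using mu by (auto simp: A_set_def)
  let ?R = "{r. lam r < mu r}"
  have fin: "finite ?R"
    using is_partition_pos_row[OF part] by (intro finite_subset[of ?R "{..<m}"]) auto
  have "?R \<noteq> {}"
    using False le by (metis (mono_tags, lifting) Collect_empty_eq antisym le_fun_def not_less)
  \<comment> \<open>With the last such row,
    \<open>mu (Suc r) \<le> lam (Suc r) \<le> lam r < mu r\<close>, so its last box is a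
    corner.\<close>
  define r where "r = Max ?R"
  have r: "lam r < mu r" using Max_in[OF fin \<open>?R \<noteq> {}\<close>] by (simp add: r_def)
  have "Suc r \<notin> ?R" using Max_ge[OF fin, of "Suc r"] by (auto simp: r_def)
  then have corner: "mu (Suc r) < mu r"
    using r is_partition_antimonoD[OF lam, of r "Suc r"] by simp
  let ?nu = "mu(r := mu r - 1)"
  have nu: "?nu \<in> A_set m h lam" by (rule remove_box_mem_A_set[OF h mu r corner])
  moreover have "part_size m ?nu \<noteq> part_size m mu"
    using sum_remove_box[of "{..<m}" mu r] r is_partition_pos_row[OF part r] by (simp add: part_size_def)
  \<comment> \<open>A box removed from a row \<open>r \<ge> t\<close> would push the tail sum below
    its minimum.\<close>
  moreover have "sum ?nu {t..<m} = sum mu {t..<m}"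
    using min[OF nu] sum_remove_box[of "{t..<m}" mu r] r by (simp split: if_splits)
  ultimately show ?thesis by blast
next
  case True
  then obtain r where r: "0 < r" "r < t" "lam r < lam (r - 1)" using ne by blast
  have part: "is_partition m mu" using mu by (simp add: A_set_def)
  have "is_partition m (mu(r := Suc (mu r)))"
    using r t True by (intro is_partition_add_box[OF part]) auto
  then have add: "addable_row m h lam mu r"
    using r h t True by (simp add: addable_row_def)
  let ?nu = "mu(r := Suc (mu r))"
  have nu: "?nu \<in> A_set m h lam" by (rule add_box_mem_A_set[OF h mu add])
  moreover have "part_size m ?nu \<noteq> part_size m mu"
    using part_size_add_box[of r m mu] r t by simp
  moreover have "sum ?nu {t..<m} = sum mu {t..<m}"
    using sum_add_box[of "{t..<m}" mu r] r by simp
  ultimately show ?thesis by blast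
qed


section \<open>Facets\<close>

text \<open>For equal parts the polytope is contained in a point, and a nonempty facet would need
  negative dimension. For unequal parts the dimension bound for the polytope passes to its
  facets.\<close>

lemma facet_newton_polytope_schur:
  fixes F :: "(real ^ 'm::{finite,linorder}) set"
  assumes part: "is_partition CARD('m) mu" and F: "F facet_of newton_polytope (schur mu)"
  shows "mu (CARD('m) - 1) < mu 0" and "int CARD('m) - 2 \<le> aff_dim F"
proof -
  let ?P = "newton_polytope (schur mu :: 'm int_mpoly)"
  have F': "F \<noteq> {}" "aff_dim F = aff_dim ?P - 1" using F by (auto simp: facet_of_def)
  show less: "mu (CARD('m) - 1) < mu 0"
  proof (rule ccontr)
    assume "\<not> mu (CARD('m) - 1) < mu 0"
    then have "mu 0 \<le> mu (CARD('m) - 1)" by simp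
    have const: "mu r = mu 0" if "r < CARD('m)" for r
    proof (rule antisym)
      show "mu r \<le> mu 0" by (rule is_partition_antimonoD[OF part]) simp
      have "r \<le> CARD('m) - 1" using that by linarith
      from is_partition_antimonoD[OF part this] show "mu 0 \<le> mu r"
        using \<open>mu 0 \<le> mu (CARD('m) - 1)\<close> by simp
    qed
    have "part_size CARD('m) mu = (\<Sum>r<CARD('m). mu 0)"
      unfolding part_size_def by (intro sum.cong refl const) simp
    then have size: "part_size CARD('m) mu = CARD('m) * mu 0" by simp
    \<comment> \<open>The numbers \<open>real (mu 0) - x $ i\<close> are nonnegative and sum to
      0.\<close>
    have "?P \<subseteq> {\<chi> i. real (mu 0)}"
    proof
      fix x assume x: "x \<in> ?P"
      have "(\<Sum>i\<in>UNIV. real (mu 0) - x $ i) = 0"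
        using newton_polytope_schur_sum[OF part x] size by (simp add: sum_subtractf)
      then have "real (mu 0) - x $ i = 0" for i
        using newton_polytope_schur_le[OF part x]
        by (subst (asm) sum_nonneg_eq_0_iff) auto
      then show "x \<in> {\<chi> i. real (mu 0)}" by (simp add: vec_eq_iff)
    qed
    then have "aff_dim ?P \<le> 0" by (metis aff_dim_sing aff_dim_subset)
    then have "aff_dim F < 0" using F' by simp
    moreover obtain x where "{x} \<subseteq> F" using F'(1) by blast
    then have "0 \<le> aff_dim F" by (metis aff_dim_sing aff_dim_subset)
    ultimately show False by simp
  qed
  show "int CARD('m) - 2 \<le> aff_dim F"
    using aff_dim_newton_polytope_schur[OF part less] F'(2) by simp
qed

text \<open>One can add three points to \<open>F\<close>, each violating one of the three equations that hold for
  the points before it.\<close>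

lemma aff_dim_equal_coordinates:
  fixes F :: "(real ^ 'm::finite) set"
  assumes ij: "i \<noteq> j" and k: "k \<noteq> i" "k \<noteq> j"
    and F: "F \<noteq> {}" "\<And>x. x \<in> F \<Longrightarrow> x $ i = c" "\<And>x. x \<in> F \<Longrightarrow> x $ j = c"
      "\<And>x. x \<in> F \<Longrightarrow> (\<Sum>i\<in>UNIV. x $ i) = s"
  shows "aff_dim F \<le> int CARD('m) - 3"
proof -
  obtain p where p: "p \<in> F" using F(1) by blast
  \<comment> \<open>\<open>?q1\<close> changes coordinate \<open>i\<close> but keeps coordinate
    \<open>j\<close> and the total, \<open>?q2\<close> changes coordinate \<open>j\<close> but keeps
    the total, and \<open>?q3\<close> changes the total.\<close>
  let ?q1 = "p + axis i 1 - axis k 1" and ?q2 = "p + axis j 1 - axis k 1" and ?q3 = "p + axis k 1"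
  have total: "(\<Sum>i\<in>UNIV. axis l (1::real) $ i) = 1" for l :: 'm
    by (simp add: axis_def)
  have "aff_dim (insert ?q1 F) = aff_dim F + 1"
    using F(2) p ij k by (intro aff_dim_insert_coord_sum[where I = "{i}" and c = c]) (auto simp: axis_def)
  moreover have "aff_dim (insert ?q2 (insert ?q1 F)) = aff_dim (insert ?q1 F) + 1"
    using F(3) p ij k by (intro aff_dim_insert_coord_sum[where I = "{j}" and c = c]) (auto simp: axis_def)
  moreover have "aff_dim (insert ?q3 (insert ?q2 (insert ?q1 F))) = aff_dim (insert ?q2 (insert ?q1 F)) + 1"
    using F(4) p by (intro aff_dim_insert_coord_sum[where I = UNIV and c = s])
      (auto simp: sum.distrib sum_subtractf total)
  moreover have "aff_dim (insert ?q3 (insert ?q2 (insert ?q1 F))) \<le> int CARD('m)"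
    using aff_dim_le_DIM[of "insert ?q3 (insert ?q2 (insert ?q1 F))"] by simp
  ultimately show ?thesis by linarith
qed

section \<open>From the facet of the Schur polytope to the hyperplane\<close>

lemma sum_Compl_eq:
  fixes x :: "real ^ 'm::finite"
  shows "(\<Sum>i\<in>- I. x $ i) = (\<Sum>i\<in>UNIV. x $ i) - (\<Sum>i\<in>I. x $ i)"
  using sum.union_disjoint[of I "- I" "\<lambda>i. x $ i"] by simp

lemma part_size_split: "t \<le> m \<Longrightarrow> part_size m mu = sum mu {..<t} + sum mu {t..<m}"
  unfolding part_size_def
  by (metis add.commute ivl_disj_int_one(2) ivl_disj_un_one(2) finite_lessThan finite_atLeastLessThan sum.union_disjoint)

text \<open>\<open>F\<close> contributes dimension at least \<open>m - 2\<close> in one slice of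
  constant coordinate sum, and \<open>x\<close> from another slice adds one. The dimension of
  \<open>H\<close> bounds the result by \<open>m - 1\<close>.\<close>

lemma facet_defining_of_other_size:
  fixes H F :: "(real ^ 'm::{finite,linorder}) set"
  assumes h: "h \<ge> 1" and mu: "mu \<in> A_set CARD('m) h lam"
    and F: "F facet_of newton_polytope (schur mu)" "F \<subseteq> H"
    and iso: "isolates H (newton_polytope (G_poly h lam))"
    and nu: "nu \<in> A_set CARD('m) h lam" "part_size CARD('m) nu \<noteq> part_size CARD('m) mu"
    and x: "x \<in> newton_polytope (schur nu)" "x \<in> H"
  shows "facet_defining H (newton_polytope (G_poly h lam))"
proof -
  let ?G = "newton_polytope (G_poly h lam :: 'm int_mpoly)"
  have part: "is_partition CARD('m) mu" "is_partition CARD('m) nu"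
    using mu nu(1) by (auto simp: A_set_def)
  have sub: "F \<subseteq> newton_polytope (schur mu)" by (rule facet_of_imp_subset[OF F(1)])
  have "aff_dim (insert x F) = aff_dim F + 1"
  proof (rule aff_dim_insert_coord_sum[where I = UNIV])
    show "(\<Sum>i\<in>UNIV. y $ i) = real (part_size CARD('m) mu)" if "y \<in> F" for y
      using newton_polytope_schur_sum[OF part(1)] sub that by blast
    show "(\<Sum>i\<in>UNIV. x $ i) \<noteq> real (part_size CARD('m) mu)"
      using newton_polytope_schur_sum[OF part(2) x(1)] nu(2) by simp
  qed
  moreover have "insert x F \<subseteq> ?G \<inter> H"
    using sub F(2) x newton_polytope_schur_subset[OF h mu] newton_polytope_schur_subset[OF h nu(1)]
    by blast
  then have "aff_dim (insert x F) \<le> aff_dim (?G \<inter> H)" by (rule aff_dim_subset)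
  moreover have "aff_dim (?G \<inter> H) \<le> aff_dim H" by (intro aff_dim_subset) auto
  ultimately have "aff_dim (?G \<inter> H) = int CARD('m) - 1"
    using facet_newton_polytope_schur(2)[OF part(1) F(1)] isolates_imp_aff_dim_le[OF iso]
    by linarith
  then show ?thesis using iso by (simp add: facet_defining_def)
qed

text \<open>Some point \<open>u\<close> of the Schur polytope lies strictly on one side of
  \<open>H\<close>, so isolation puts the whole polytope of \<open>G_poly h lam\<close> on that
  side. Tested at the points \<open>pt nu\<close>, this makes \<open>mu\<close> extremal for its
  head or tail sum, as the box moves require.\<close>

lemma facet_defining_of_A_set:
  fixes H F :: "(real ^ 'm::{finite,linorder}) set"
  assumes h: "h \<ge> 1"
    and lam: "is_partition CARD('m) lam" "lam (CARD('m) - 1) = 0"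
    and mu: "mu \<in> A_set CARD('m) h lam"
    and I: "I \<noteq> {}" "I \<noteq> UNIV"
    and L: "L = (\<Sum>i<card I. mu i)"
    and F: "F = newton_polytope (schur mu) \<inter> {x. (\<Sum>i\<in>I. x $ i) = real L}"
    and F_facet: "F facet_of newton_polytope (schur mu)"
    and H: "H = {x. (\<Sum>i\<in>I. x $ i) = real L} \<or>
            H = {x. (\<Sum>i\<in>-I. x $ i) = real (part_size CARD('m) mu) - real L}"
    and iso: "isolates H (newton_polytope (G_poly h lam))"
    and H_not_J: "\<forall>j. H \<noteq> J_plane lam j"
  shows "facet_defining H (newton_polytope (G_poly h lam))"
proof -
  let ?m = "CARD('m)" and ?t = "card I"
  let ?G = "newton_polytope (G_poly h lam :: 'm int_mpoly)"
  have part: "is_partition ?m mu" using mu by (simp add: A_set_def)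
  have t: "0 < ?t" "?t < ?m"
    using I by (auto simp: card_gt_0_iff intro: psubset_card_mono)
  note less = facet_newton_polytope_schur(1)[OF part F_facet]
  obtain \<sigma> where \<sigma>: "bij_betw \<sigma> UNIV {..<?m}" "\<sigma> ` I = {..<?t}"
    using ex_bij_betw_prefix by blast
  define pt where "pt nu = ((\<chi> i. real (nu (\<sigma> i))) :: real ^ 'm::{finite,linorder})" for nu :: "nat \<Rightarrow> nat"
  have pt: "pt nu \<in> newton_polytope (schur nu)" if "nu \<in> A_set ?m h lam" for nu
    unfolding pt_def using permuted_mem_newton_polytope_schur[OF _ \<sigma>(1), of nu] that
    by (simp add: A_set_def)
  have pt_G: "pt nu \<in> ?G" if "nu \<in> A_set ?m h lam" for nu
    using pt[OF that] newton_polytope_schur_subset[OF h that] by blast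
  have pt_I: "(\<Sum>i\<in>I. pt nu $ i) = real (sum nu {..<?t})"
    and pt_J: "(\<Sum>i\<in>- I. pt nu $ i) = real (sum nu {?t..<?m})" for nu
    unfolding pt_def by (rule coord_sum_permuted[OF \<sigma>])+
  obtain u where u: "u \<in> newton_polytope (schur mu)" "(\<Sum>i\<in>I. u $ i) < real L"
    using ex_newton_polytope_schur_less[OF part less I] L by blast
  then have u_G: "u \<in> ?G" using newton_polytope_schur_subset[OF h mu] by blast
  have size: "part_size ?m mu = L + sum mu {?t..<?m}"
    using part_size_split[of ?t ?m mu] t L by simp
  from H show ?thesis
  proof
    assume H: "H = {x. (\<Sum>i\<in>I. x $ i) = real L}"
    have max: "sum nu {..<?t} \<le> sum mu {..<?t}" if "nu \<in> A_set ?m h lam" for nu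
      using isolates_not_both_sides[OF iso[unfolded H] linear_coord_sum u_G pt_G[OF that] u(2)]
      by (simp only: pt_I L of_nat_le_iff)
    obtain nu where nu: "nu \<in> A_set ?m h lam" "part_size ?m nu \<noteq> part_size ?m mu"
        "sum nu {..<?t} = sum mu {..<?t}"
      using ex_A_set_same_head[OF h lam(2) mu less t(2) max] by blast
    show ?thesis
      using nu F by (intro facet_defining_of_other_size[OF h mu F_facet _ iso nu(1,2) pt[OF nu(1)]])
        (auto simp: H pt_I L)
  next
    assume H: "H = {x. (\<Sum>i\<in>-I. x $ i) = real (part_size ?m mu) - real L}"
    \<comment> \<open>The signs are reversed so that \<open>u\<close> again lies on the smaller
      side.\<close>
    have H': "H = {x. - (\<Sum>i\<in>-I. x $ i) = - real (sum mu {?t..<?m})}"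
      unfolding H size by auto
    have linear: "linear (\<lambda>x :: real ^ 'm::{finite,linorder}. - (\<Sum>i\<in>-I. x $ i))"
      using linear_compose_neg[OF linear_coord_sum] .
    have u': "- (\<Sum>i\<in>-I. u $ i) < - real (sum mu {?t..<?m})"
      using u(2) newton_polytope_schur_sum[OF part u(1)] size by (simp add: sum_Compl_eq)
    have min: "sum mu {?t..<?m} \<le> sum nu {?t..<?m}" if "nu \<in> A_set ?m h lam" for nu
      using isolates_not_both_sides[OF iso[unfolded H'] linear u_G pt_G[OF that] u']
      unfolding pt_J by linarith
    \<comment> \<open>The exceptional case is \<open>mu = lam\<close> with equal parts in the first
      \<open>?t\<close> rows. For \<open>?t = 1\<close> it turns \<open>H\<close> into a
      \<open>J_plane\<close>; for larger \<open>?t\<close> it makes \<open>F\<close> too small for a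
      facet.\<close>
    have "mu \<noteq> lam \<or> (\<exists>r. 0 < r \<and> r < ?t \<and> lam r < lam (r - 1))"
    proof (rule ccontr)
      assume contra: "\<not> ?thesis"
      then have eq: "mu = lam" by blast
      have flat: "lam (r - 1) \<le> lam r" if "0 < r" "r < ?t" for r
        using contra that by (meson not_less)
      have const: "lam r = lam 0" if "r < ?t" for r
        using that
      proof (induction r)
        case (Suc r)
        then show ?case
          using flat[of "Suc r"] is_partition_antimonoD[OF lam(1), of r "Suc r"] by simp
      qed simp
      have "L = (\<Sum>r<?t. lam 0)" unfolding L eq by (intro sum.cong refl const) simp
      then have L': "L = ?t * lam 0" by simp
      obtain i where i: "i \<in> I" using I by blast
      show False
      proof (cases "?t = 1")
        case True
        then have "I = {i}" using i by (auto simp: card_1_singleton_iff)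
        then have "- I = UNIV - {i}" by auto
        then have "H = J_plane lam i"
          using True L' by (simp add: H J_plane_def eq)
        then show False using H_not_J by blast
      next
        case False
        then have "I \<noteq> {i}" by auto
        then obtain j where j: "j \<in> I" "j \<noteq> i" using i by blast
        obtain k where k: "k \<notin> I" using I by blast
        \<comment> \<open>On \<open>F\<close> the coordinates in \<open>I\<close> sum to
          \<open>?t * lam 0\<close>, while none exceeds \<open>lam 0\<close>.\<close>
        have coord: "x $ l = real (lam 0)" if x: "x \<in> F" and l: "l \<in> I" for x l
        proof -
          have xP: "x \<in> newton_polytope (schur mu)" and "(\<Sum>i\<in>I. x $ i) = real L"
            using x F by auto
          then have "(\<Sum>i\<in>I. real (lam 0) - x $ i) = 0"
            by (simp add: sum_subtractf L')
          then show ?thesis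
            using newton_polytope_schur_le[OF part xP] l
            by (subst (asm) sum_nonneg_eq_0_iff) (auto simp: eq)
        qed
        have "aff_dim F \<le> int ?m - 3"
        proof (rule aff_dim_equal_coordinates)
          show "i \<noteq> j" "k \<noteq> i" "k \<noteq> j" using i j k by auto
          show "F \<noteq> {}" using F_facet unfolding facet_of_def by blast
          show "x $ i = real (lam 0)" "x $ j = real (lam 0)" if "x \<in> F" for x
            using coord[OF that] i j(1) by auto
          show "(\<Sum>i\<in>UNIV. x $ i) = real (part_size ?m mu)" if "x \<in> F" for x
            using newton_polytope_schur_sum[OF part] facet_of_imp_subset[OF F_facet] that by blast
        qed
        then show False using facet_newton_polytope_schur(2)[OF part F_facet] by simp
      qed
    qed
    then obtain nu where nu: "nu \<in> A_set ?m h lam" "part_size ?m nu \<noteq> part_size ?m mu"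
        "sum nu {?t..<?m} = sum mu {?t..<?m}"
      using ex_A_set_same_tail[OF h lam(1) mu t(2) min] by blast
    show ?thesis
    proof (rule facet_defining_of_other_size[OF h mu F_facet _ iso nu(1,2) pt[OF nu(1)]])
      show "F \<subseteq> H"
        using newton_polytope_schur_sum[OF part] by (auto simp: F H sum_Compl_eq)
      show "pt nu \<in> H" using nu(3) by (simp add: H pt_J size)
    qed
  qed
qed

text \<open>The degree is attained at a monomial of some \<open>schur nu\<close>, which is
  homogeneous of degree \<open>part_size CARD('m) nu\<close>.\<close>

lemma ex_A_set_total_deg:
  assumes "h \<ge> 1" "is_partition CARD('m) lam"
    and "total_deg (G_poly h lam :: 'm::{finite,linorder} int_mpoly) = part_size CARD('m) lam + N"
  shows "\<exists>nu\<in>A_set CARD('m) h lam. part_size CARD('m) nu = part_size CARD('m) lam + N"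
proof -
  let ?D = "(\<lambda>\<alpha>. \<Sum>i\<in>UNIV. Poly_Mapping.lookup \<alpha> i) ` Poly_Mapping.keys (G_poly h lam :: 'm int_mpoly)"
  have "Max (insert 0 ?D) \<in> insert 0 ?D" by (rule Max_in) auto
  then have "part_size CARD('m) lam + N \<in> insert 0 ?D"
    using assms(3) by (simp add: total_deg_def)
  then show ?thesis
  proof
    \<comment> \<open>The default value 0 in \<open>total_deg\<close>: here \<open>N = 0\<close>,
      and \<open>lam\<close> itself has the required size.\<close>
    assume "part_size CARD('m) lam + N = 0"
    then have "lam \<in> A_set CARD('m) h lam" "part_size CARD('m) lam = part_size CARD('m) lam + N"
      using assms(2) mem_A_set_iff[OF assms(1)] by auto
    then show ?thesis by blast
  next
    assume "part_size CARD('m) lam + N \<in> ?D"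
    then obtain nu \<alpha> where nu: "nu \<in> A_set CARD('m) h lam"
        "\<alpha> \<in> Poly_Mapping.keys (schur nu :: 'm int_mpoly)"
        "part_size CARD('m) lam + N = (\<Sum>i\<in>UNIV. Poly_Mapping.lookup \<alpha> i)"
      unfolding keys_G_poly[OF assms(1)] by blast
    have part: "is_partition CARD('m) nu" using nu(1) by (simp add: A_set_def)
    obtain T :: "nat \<times> nat \<Rightarrow> 'm" where "\<alpha> = tableau_weight nu T"
      using nu(2) keys_schur[OF finite_cells[OF part]] by blast
    then show ?thesis using nu sum_tableau_weight[OF part, of T] by metis
  qed
qed

theorem theorem4p15:
  fixes h N k :: nat
    and lam a b mu :: "nat \<Rightarrow> nat"
    and L :: nat
    and I :: "'m::{finite,linorder} set"
    and F H :: "(real ^ 'm::{finite,linorder}) set"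
  assumes m: "CARD('m) \<ge> 2"
    and h: "h \<ge> 1"
    and lam: "is_partition CARD('m) lam" "lam (CARD('m) - 1) = 0"
    and N: "total_deg (G_poly h lam :: 'm int_mpoly) = part_size CARD('m) lam + N"
    and a: "\<forall>r<CARD('m). dom_part CARD('m) h lam N r = lam r + a r"
    and b: "\<forall>j. b j = (\<Sum>i<j. a i)"
    and k: "k \<in> {1..CARD('m)}"
    and I: "I \<noteq> {}" "I \<noteq> UNIV"
    and mu: "mu = dom_part CARD('m) h lam (b k)"
    and L: "L = (\<Sum>i<card I. mu i)"
    and F: "F = newton_polytope (schur mu) \<inter> {x. (\<Sum>i\<in>I. x $ i) = real L}"
    and F_facet: "F facet_of newton_polytope (schur mu)"
    and H: "H = {x. (\<Sum>i\<in>I. x $ i) = real L} \<or>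
            H = {x. (\<Sum>i\<in>-I. x $ i) = real (part_size CARD('m) mu) - real L}"
    and H_isolates: "isolates H (newton_polytope (G_poly h lam))"
    and H_not_J: "\<forall>j. H \<noteq> J_plane lam j"
  shows "facet_defining H (newton_polytope (G_poly h lam))"
proof -
  obtain nu where nu: "nu \<in> A_set CARD('m) h lam" "part_size CARD('m) nu = part_size CARD('m) lam + N"
    using ex_A_set_total_deg[OF h lam(1) N] by blast
  note dom = dom_part_mem_A_set[OF h lam(1) nu]
  \<comment> \<open>Each step adds one box, so comparing sizes gives \<open>N\<close> as the sum of
    all \<open>a r\<close>. Hence \<open>b k \<le> N\<close>, and the index of \<open>mu\<close>
    lies in the meaningful range of \<open>dom_part\<close>.\<close>
  have "part_size CARD('m) (dom_part CARD('m) h lam N) = part_size CARD('m) lam + (\<Sum>r<CARD('m). a r)"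
    using a by (simp add: part_size_def sum.distrib)
  then have "(\<Sum>r<CARD('m). a r) = N" using dom[of N] by simp
  moreover have "b k \<le> (\<Sum>r<CARD('m). a r)"
    using b k by (auto intro: sum_mono2)
  ultimately have "mu \<in> A_set CARD('m) h lam" using dom[of "b k"] mu by simp
  then show ?thesis
    by (rule facet_defining_of_A_set[OF h lam _ I L F F_facet H H_isolates H_not_J])
qed

end
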